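(* Let $(\gamma,c)$ and $(\gamma',c')$ be two colored trivalent graphs related by (a finite sequence of) elementary transformations. Then the graph potentials $\widetilde W_{\gamma,c}$ and $\widetilde W_{\gamma',c'}$ are identified via a rational change of coordinates, i.e. there is a birational map $\varphi$ from the torus $\operatorname{Spec}\mathbb{C}[x_e^{\pm1}: e\in E(\gamma)]$ to the torus $\operatorname{Spec}\mathbb{C}[x_e^{\pm1}: e\in E(\gamma')]$ such that $\varphi^*\widetilde W_{\gamma',c'}=\widetilde W_{\gamma,c}$.
   Context: A trivalent graph $\gamma=(V,E)$ is a finite connected undirected graph (loops and multiple edges allowed) in which every vertex is incident to exactly three half-edges; $g$ denotes its first Betti number, so $\#V=2g-2$, $\#E=3g-3$. A coloring is a function $c\colon V\to\mathbb{F}_2$. Attach a variable $x_e$ to each edge $e$. For a vertex $v$ whose three half-edges belong to edges with variables $x_i,x_j,x_k$ (a loop contributes its variable twice), the vertex potential is $$\widetilde W_{v,c}=\sum_{(s_i,s_j,s_k)\in\mathbb{F}_2^3,\ s_i+s_j+s_k=c(v)}x_i^{(-1)^{s_i}}x_j^{(-1)^{s_j}}x_k^{(-1)^{s_k}},$$ and the graph potential is the Laurent polynomial $\widetilde W_{\gamma,c}=\sum_{v\in V}\widetilde W_{v,c}$ in the variables $x_e$, $e\in E$. Elementary transformation: let $e$ be a non-loop edge of $\gamma$ joining distinct vertices $v_1,v_2$; let $h_a,h_b$ be the two other half-edges at $v_1$ and $h_c,h_d$ the two other half-edges at $v_2$ (some of these may belong to the same edge). The transformed graph $\gamma'$ has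 the same vertices and edges, but $v_1$ is now incident to $e,h_a,h_c$ and $v_2$ to $e,h_b,h_d$; everything else, including the color of every vertex, is unchanged. *)

theory Defs
  imports Complex_Main
    "HOL-Library.FuncSet"
    "HOL-Library.Poly_Mapping"
    "HOL-Library.Z2"
begin

section \<open>Colored trivalent graphs\<close>

text \<open>
  Graphs are given by their half-edges: a half-edge \<open>h\<close> is attached to the vertex
  \<open>vert_of G h\<close> and belongs to the edge \<open>edge_of G h\<close>.  Loops and multiple edges need no
  special treatment.  The type \<open>bit\<close> is the field with two elements.  The functions
  \<open>vert_of\<close>, \<open>edge_of\<close> and \<open>color\<close> only matter on \<open>halves\<close>, \<open>halves\<close> and \<open>verts\<close>.
\<close>

record ('v, 'h, 'e) colored_graph =
  verts :: "'v set"
  edges :: "'e set"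
  halves :: "'h set"
  vert_of :: "'h \<Rightarrow> 'v"
  edge_of :: "'h \<Rightarrow> 'e"
  color :: "'v \<Rightarrow> bit"

definition halves_at :: "('v, 'h, 'e) colored_graph \<Rightarrow> 'v \<Rightarrow> 'h set" where
  "halves_at G v = {h \<in> halves G. vert_of G h = v}"

definition halves_in :: "('v, 'h, 'e) colored_graph \<Rightarrow> 'e \<Rightarrow> 'h set" where
  "halves_in G e = {h \<in> halves G. edge_of G h = e}"

definition adjacency :: "('v, 'h, 'e) colored_graph \<Rightarrow> ('v \<times> 'v) set" where
  "adjacency G = {(vert_of G h, vert_of G h') | h h'.
     h \<in> halves G \<and> h' \<in> halves G \<and> h \<noteq> h' \<and> edge_of G h = edge_of G h'}"

definition trivalent_graph :: "('v, 'h, 'e) colored_graph \<Rightarrow> bool" where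
  "trivalent_graph G \<longleftrightarrow>
     finite (verts G) \<and> finite (edges G) \<and> finite (halves G) \<and>
     vert_of G \<in> halves G \<rightarrow> verts G \<and>
     edge_of G \<in> halves G \<rightarrow> edges G \<and>
     (\<forall>e\<in>edges G. card (halves_in G e) = 2) \<and>
     (\<forall>v\<in>verts G. card (halves_at G v) = 3) \<and>
     verts G \<noteq> {} \<and> (\<forall>u\<in>verts G. \<forall>v\<in>verts G. (u, v) \<in> (adjacency G)\<^sup>*)"

text \<open>
  The half-edges \<open>h1\<close> and \<open>h2\<close> are the two halves of the non-loop edge \<open>e\<close>; they stay at
  \<open>v1\<close> and \<open>v2\<close> respectively, while \<open>hb\<close> and \<open>hc\<close> are exchanged.
\<close>

definition elementary_transformation ::
    "('v, 'h, 'e) colored_graph \<Rightarrow> ('v, 'h, 'e) colored_graph \<Rightarrow> bool" where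
  "elementary_transformation G G' \<longleftrightarrow>
     verts G' = verts G \<and> edges G' = edges G \<and> halves G' = halves G \<and>
     (\<forall>h\<in>halves G. edge_of G' h = edge_of G h) \<and>
     (\<forall>v\<in>verts G. color G' v = color G v) \<and>
     (\<exists>e v1 v2 h1 h2 ha hb hc hd.
        e \<in> edges G \<and> v1 \<in> verts G \<and> v2 \<in> verts G \<and> v1 \<noteq> v2 \<and>
        distinct [h1, h2, ha, hb, hc, hd] \<and>
        halves_in G e = {h1, h2} \<and>
        halves_at G v1 = {h1, ha, hb} \<and> halves_at G v2 = {h2, hc, hd} \<and>
        halves_at G' v1 = {h1, ha, hc} \<and> halves_at G' v2 = {h2, hb, hd} \<and>
        (\<forall>h\<in>halves G - {h1, h2, ha, hb, hc, hd}. vert_of G' h = vert_of G h))"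


section \<open>Laurent polynomials and the graph potential\<close>

text \<open>
  A monomial is its finitely supported exponent vector, so the ring of Laurent polynomials in
  variables indexed by \<open>'e\<close> is the group algebra of \<open>'e \<Rightarrow>\<^sub>0 int\<close>.
\<close>

type_synonym 'e laurent = "('e \<Rightarrow>\<^sub>0 int) \<Rightarrow>\<^sub>0 complex"

definition laurent_in :: "'e set \<Rightarrow> 'e laurent set" where
  "laurent_in E = {p. \<forall>m\<in>Poly_Mapping.keys p. Poly_Mapping.keys m \<subseteq> E}"

definition laurent_eval :: "'e laurent \<Rightarrow> ('e \<Rightarrow> complex) \<Rightarrow> complex" where
  "laurent_eval p x = (\<Sum>m\<in>Poly_Mapping.keys p. Poly_Mapping.lookup p m *
     (\<Prod>e\<in>Poly_Mapping.keys m. x e powi Poly_Mapping.lookup m e))"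

text \<open>The Laurent monomial $x_e^{(-1)^s}$.\<close>

definition signed_var :: "'e \<Rightarrow> bit \<Rightarrow> 'e laurent" where
  "signed_var e s =
     Poly_Mapping.single (Poly_Mapping.single e (if s = 0 then 1 else - 1)) 1"

text \<open>
  The product runs over half-edges rather than edges, so that a loop at \<open>v\<close> contributes its
  variable twice, with independent signs.
\<close>

definition vertex_potential :: "('v, 'h, 'e) colored_graph \<Rightarrow> 'v \<Rightarrow> 'e laurent" where
  "vertex_potential G v =
     (\<Sum>s \<in> {s \<in> halves_at G v \<rightarrow>\<^sub>E UNIV. (\<Sum>h\<in>halves_at G v. s h) = color G v}.
        \<Prod>h\<in>halves_at G v. signed_var (edge_of G h) (s h))"

definition graph_potential :: "('v, 'h, 'e) colored_graph \<Rightarrow> 'e laurent" where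
  "graph_potential G = (\<Sum>v\<in>verts G. vertex_potential G v)"


section \<open>Birational maps between tori\<close>

text \<open>
  The torus with coordinate ring \<open>laurent_in E\<close> is treated as a classical variety over the
  complex numbers, i.e. through its closed points.
\<close>

definition torus :: "'e set \<Rightarrow> ('e \<Rightarrow> complex) set" where
  "torus E = E \<rightarrow>\<^sub>E (UNIV - {0})"

definition zariski_open :: "'e set \<Rightarrow> ('e \<Rightarrow> complex) set \<Rightarrow> bool" where
  "zariski_open E U \<longleftrightarrow>
     (\<exists>S \<subseteq> laurent_in E. U = {x \<in> torus E. \<exists>p\<in>S. laurent_eval p x \<noteq> 0})"

definition regular_function ::
    "'e set \<Rightarrow> ('e \<Rightarrow> complex) set \<Rightarrow> (('e \<Rightarrow> complex) \<Rightarrow> complex) \<Rightarrow> bool" where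
  "regular_function E U f \<longleftrightarrow>
     (\<forall>x\<in>U. \<exists>V p q. zariski_open E V \<and> x \<in> V \<and> V \<subseteq> U \<and>
        p \<in> laurent_in E \<and> q \<in> laurent_in E \<and>
        (\<forall>y\<in>V. laurent_eval q y \<noteq> 0 \<and> f y = laurent_eval p y / laurent_eval q y))"

text \<open>
  A rational map from \<open>torus E\<close> to \<open>torus E'\<close> is represented by a morphism \<open>f\<close> on a nonempty
  (hence dense, the torus being irreducible) Zariski open subset \<open>U\<close>.
\<close>

definition rational_map ::
    "'e set \<Rightarrow> 'f set \<Rightarrow> ('e \<Rightarrow> complex) set \<Rightarrow> (('e \<Rightarrow> complex) \<Rightarrow> ('f \<Rightarrow> complex)) \<Rightarrow> bool"
  where
  "rational_map E E' U f \<longleftrightarrow>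
     zariski_open E U \<and> U \<noteq> {} \<and> f \<in> U \<rightarrow> torus E' \<and>
     (\<forall>e\<in>E'. regular_function E U (\<lambda>x. f x e))"

definition dominant ::
    "'f set \<Rightarrow> ('e \<Rightarrow> complex) set \<Rightarrow> (('e \<Rightarrow> complex) \<Rightarrow> ('f \<Rightarrow> complex)) \<Rightarrow> bool" where
  "dominant E' U f \<longleftrightarrow> (\<forall>V. zariski_open E' V \<and> V \<noteq> {} \<longrightarrow> f ` U \<inter> V \<noteq> {})"

text \<open>
  Dominance makes both composites rational maps, and each of them has to be the identity
  wherever the composite of the chosen representatives is defined.
\<close>

definition birational_map ::
    "'e set \<Rightarrow> 'f set \<Rightarrow> ('e \<Rightarrow> complex) set \<Rightarrow> (('e \<Rightarrow> complex) \<Rightarrow> ('f \<Rightarrow> complex)) \<Rightarrow> bool"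
  where
  "birational_map E E' U f \<longleftrightarrow>
     rational_map E E' U f \<and> dominant E' U f \<and>
     (\<exists>V g. rational_map E' E V g \<and> dominant E V g \<and>
        (\<forall>x\<in>U. f x \<in> V \<longrightarrow> g (f x) = x) \<and>
        (\<forall>y\<in>V. g y \<in> U \<longrightarrow> f (g y) = y))"

end

theory Submission
  imports Defs "HOL-Complex_Analysis.Conformal_Mappings"
begin

no_notation Polytope.edge_of (infixr \<open>(edge'_of)\<close> 50)
hide_const (open) Polytope.edge_of

text \<open>
  For an elementary transformation at \<open>e\<close>, the two vertex potentials at the ends of \<open>e\<close> add up to
  \<open>x\<^sub>e P + P' / x\<^sub>e\<close> before and \<open>x\<^sub>e Q + Q' / x\<^sub>e\<close> after the exchange, where \<open>P\<close>, \<open>P'\<close>, \<open>Q\<close>, \<open>Q'\<close> do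
  not involve \<open>x\<^sub>e\<close>.  Since \<open>P P' = Q Q'\<close>, the substitution \<open>x\<^sub>e \<mapsto> x\<^sub>e P / Q\<close> identifies the two
  potentials, and it is invertible where \<open>P Q \<noteq> 0\<close>.  Isomorphisms between nonempty principal open
  subsets of the torus compose because the torus is irreducible.
\<close>

section \<open>Evaluation of Laurent polynomials\<close>

definition monomial_eval :: "('e \<Rightarrow>\<^sub>0 int) \<Rightarrow> ('e \<Rightarrow> complex) \<Rightarrow> complex" where
  "monomial_eval m x = (\<Prod>e\<in>Poly_Mapping.keys m. x e powi Poly_Mapping.lookup m e)"

lemma torus_nonzero: "x \<in> torus E \<Longrightarrow> e \<in> E \<Longrightarrow> x e \<noteq> 0"
  by (auto simp: torus_def)

text \<open>Exponents off the support are 0 and contribute factors 1. Since exponents may cancel,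
  \<open>m\<close>, \<open>n\<close> and \<open>m + n\<close> have different supports; this puts
  them over one finite set.\<close>

lemma monomial_eval_superset:
  assumes "finite S" "Poly_Mapping.keys m \<subseteq> S"
  shows "monomial_eval m x = (\<Prod>e\<in>S. x e powi Poly_Mapping.lookup m e)"
  unfolding monomial_eval_def
  using assms by (intro prod.mono_neutral_left) (auto simp: in_keys_iff)

lemma monomial_eval_add:
  assumes "x \<in> torus E" "Poly_Mapping.keys m \<subseteq> E" "Poly_Mapping.keys n \<subseteq> E"
  shows "monomial_eval (m + n) x = monomial_eval m x * monomial_eval n x"
proof -
  define S where "S = Poly_Mapping.keys m \<union> Poly_Mapping.keys n"
  have S: "finite S" "Poly_Mapping.keys m \<subseteq> S" "Poly_Mapping.keys n \<subseteq> S"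
    "Poly_Mapping.keys (m + n) \<subseteq> S"
    unfolding S_def by (simp, blast, blast, rule Poly_Mapping.keys_add)
  \<comment> \<open>Powers with exponents of mixed sign add up only for a nonzero base, which the
    torus supplies.\<close>
  have "x e \<noteq> 0" if "e \<in> S" for e
    using that assms torus_nonzero[of x E e] unfolding S_def by blast
  then have "monomial_eval (m + n) x =
      (\<Prod>e\<in>S. x e powi Poly_Mapping.lookup m e * x e powi Poly_Mapping.lookup n e)"
    unfolding monomial_eval_superset[OF S(1,4)] lookup_add
    by (intro prod.cong refl power_int_add disjI1)
  then show ?thesis
    by (simp only: prod.distrib monomial_eval_superset[OF S(1,2)] monomial_eval_superset[OF S(1,3)])
qed

lemma laurent_eval_superset:
  assumes "finite S" "Poly_Mapping.keys p \<subseteq> S"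
  shows "laurent_eval p x = (\<Sum>m\<in>S. Poly_Mapping.lookup p m * monomial_eval m x)"
  unfolding laurent_eval_def monomial_eval_def
  using assms by (intro sum.mono_neutral_left) (auto simp: in_keys_iff)

lemma laurent_eval_zero: "laurent_eval 0 x = 0"
  by (simp add: laurent_eval_def)

lemma laurent_eval_single: "laurent_eval (Poly_Mapping.single m c) x = c * monomial_eval m x"
  using laurent_eval_superset[of "{m}" "Poly_Mapping.single m c" x] by simp

lemma laurent_eval_one: "laurent_eval 1 x = 1"
  by (simp add: laurent_eval_single monomial_eval_def flip: single_one)

lemma laurent_eval_add: "laurent_eval (p + q) x = laurent_eval p x + laurent_eval q x"
proof -
  define S where "S = Poly_Mapping.keys p \<union> Poly_Mapping.keys q"
  have "finite S" "Poly_Mapping.keys p \<subseteq> S" "Poly_Mapping.keys q \<subseteq> S"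
    "Poly_Mapping.keys (p + q) \<subseteq> S"
    unfolding S_def by (simp, blast, blast, rule Poly_Mapping.keys_add)
  then show ?thesis
    by (simp add: laurent_eval_superset[of S] lookup_add distrib_right sum.distrib)
qed

lemma laurent_eval_sum: "laurent_eval (\<Sum>i\<in>I. p i) x = (\<Sum>i\<in>I. laurent_eval (p i) x)"
  by (induction I rule: infinite_finite_induct) (auto simp: laurent_eval_zero laurent_eval_add)

lemma laurent_sum_monomials:
  "(\<Sum>m\<in>Poly_Mapping.keys p. Poly_Mapping.single m (Poly_Mapping.lookup p m)) = p"
  by (rule poly_mapping_eqI)
    (auto simp: lookup_sum lookup_single when_def sum.delta in_keys_iff)

text \<open>Expanding both factors into monomials reduces the claim to
  \<open>monomial_eval_add\<close>.\<close>

lemma laurent_eval_mult: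
  assumes "x \<in> torus E" "p \<in> laurent_in E" "q \<in> laurent_in E"
  shows "laurent_eval (p * q) x = laurent_eval p x * laurent_eval q x"
proof -
  let ?P = "Poly_Mapping.keys p" and ?Q = "Poly_Mapping.keys q"
  let ?a = "Poly_Mapping.lookup p" and ?b = "Poly_Mapping.lookup q"
  have "p * q = (\<Sum>m\<in>?P. Poly_Mapping.single m (?a m)) * (\<Sum>n\<in>?Q. Poly_Mapping.single n (?b n))"
    by (simp only: laurent_sum_monomials)
  also have "\<dots> = (\<Sum>m\<in>?P. \<Sum>n\<in>?Q. Poly_Mapping.single (m + n) (?a m * ?b n))"
    by (simp add: sum_product mult_single)
  finally have "laurent_eval (p * q) x =
      (\<Sum>m\<in>?P. \<Sum>n\<in>?Q. ?a m * ?b n * monomial_eval (m + n) x)"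
    by (simp add: laurent_eval_sum laurent_eval_single)
  also have "\<dots> = (\<Sum>m\<in>?P. \<Sum>n\<in>?Q. (?a m * monomial_eval m x) * (?b n * monomial_eval n x))"
    using assms by (intro sum.cong refl) (auto simp: laurent_in_def monomial_eval_add)
  also have "\<dots> = laurent_eval p x * laurent_eval q x"
    by (simp add: sum_product laurent_eval_def monomial_eval_def)
  finally show ?thesis .
qed

section \<open>Laurent polynomials in a fixed set of variables\<close>

lemma laurent_in_one: "1 \<in> laurent_in E"
  by (auto simp: laurent_in_def)

lemma laurent_in_const: "Poly_Mapping.single 0 c \<in> laurent_in E"
  by (auto simp: laurent_in_def split: if_splits)

lemma laurent_in_add: "p \<in> laurent_in E \<Longrightarrow> q \<in> laurent_in E \<Longrightarrow> p + q \<in> laurent_in E"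
  using Poly_Mapping.keys_add[of p q] unfolding laurent_in_def by blast

lemma laurent_in_mult:
  assumes "p \<in> laurent_in E" "q \<in> laurent_in E"
  shows "p * q \<in> laurent_in E"
  unfolding laurent_in_def
proof (safe)
  fix m e assume "m \<in> Poly_Mapping.keys (p * q)" "e \<in> Poly_Mapping.keys m"
  then obtain a b where "m = a + b" "a \<in> Poly_Mapping.keys p" "b \<in> Poly_Mapping.keys q"
    using Poly_Mapping.keys_mult[of p q] by auto
  then show "e \<in> E"
    using assms \<open>e \<in> Poly_Mapping.keys m\<close> Poly_Mapping.keys_add[of a b]
    unfolding laurent_in_def by blast
qed

lemma laurent_in_prod: "(\<And>i. i \<in> I \<Longrightarrow> p i \<in> laurent_in E) \<Longrightarrow> (\<Prod>i\<in>I. p i) \<in> laurent_in E"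
  by (induction I rule: infinite_finite_induct) (auto intro: laurent_in_one laurent_in_mult)

lemma laurent_eval_prod:
  assumes "x \<in> torus E" "\<And>i. i \<in> I \<Longrightarrow> p i \<in> laurent_in E"
  shows "laurent_eval (\<Prod>i\<in>I. p i) x = (\<Prod>i\<in>I. laurent_eval (p i) x)"
  using assms(2)
  by (induction I rule: infinite_finite_induct)
    (auto simp: laurent_eval_one laurent_eval_mult[OF assms(1)] laurent_in_prod)

lemma signed_var_in: "e \<in> E \<Longrightarrow> signed_var e s \<in> laurent_in E"
  by (auto simp: laurent_in_def signed_var_def split: if_splits)

lemma laurent_eval_signed_var:
  "laurent_eval (signed_var e s) x = (if s = 0 then x e else inverse (x e))"
  by (simp add: signed_var_def laurent_eval_single monomial_eval_def)

section \<open>Irreducibility of the torus\<close>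

text \<open>
  Two points of the torus are joined by the entire curve \<open>t \<mapsto> exp ((1 - t) ln x + t ln y)\<close>, along
  which Laurent polynomials are entire functions of \<open>t\<close>; the identity theorem applies.
\<close>

lemma torus_irreducible:
  assumes "x \<in> torus E" "y \<in> torus E" "p \<in> laurent_in E" "q \<in> laurent_in E"
    and "laurent_eval p x \<noteq> 0" "laurent_eval q y \<noteq> 0"
  shows "\<exists>z\<in>torus E. laurent_eval p z \<noteq> 0 \<and> laurent_eval q z \<noteq> 0"
proof (rule ccontr)
  assume *: "\<not> ?thesis"
  define z where "z t = (\<lambda>e\<in>E. exp ((1 - t) * Ln (x e) + t * Ln (y e)))" for t :: complex
  have z: "z t \<in> torus E" for t
    by (auto simp: z_def torus_def)
  \<comment> \<open>Coordinates are nonzero, so \<open>exp\<close> undoes \<open>Ln\<close>; outside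
    \<open>E\<close> both sides are \<open>undefined\<close>.\<close>
  have z0: "z 0 = x" and z1: "z 1 = y"
    using assms(1,2) by (auto simp: z_def torus_def fun_eq_iff PiE_iff extensional_def)
  have hol: "(\<lambda>t. laurent_eval r (z t)) holomorphic_on UNIV" if "r \<in> laurent_in E" for r
    unfolding laurent_eval_def
  proof (intro holomorphic_intros)
    fix m e assume "m \<in> Poly_Mapping.keys r" "e \<in> Poly_Mapping.keys m"
    then have "e \<in> E" using that by (auto simp: laurent_in_def)
    then show "(\<lambda>t. z t e) holomorphic_on UNIV"
      by (simp add: z_def) (intro holomorphic_intros)
    show "0 \<le> Poly_Mapping.lookup m e \<or> (\<forall>t\<in>UNIV. z t e \<noteq> 0)"
      using \<open>e \<in> E\<close> by (simp add: z_def)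
  qed
  \<comment> \<open>Without a common point, \<open>q\<close> would vanish along the curve on the
    nonempty open set \<open>S\<close>, hence for every \<open>t\<close>, in particular at the end
    point \<open>y\<close>.\<close>
  define S where "S = {t. laurent_eval p (z t) \<noteq> 0}"
  have "continuous_on UNIV (\<lambda>t. laurent_eval p (z t))"
    using hol[OF assms(3)] by (rule holomorphic_on_imp_continuous_on)
  then have "open S"
    unfolding S_def by (intro open_Collect_neq continuous_intros)
  moreover have "S \<noteq> {}"
    using assms(5) z0 by (auto simp: S_def)
  moreover have "laurent_eval q (z t) = 0" if "t \<in> S" for t
    using * z that by (auto simp: S_def)
  ultimately have "laurent_eval q (z 1) = 0"
    using analytic_continuation_open[of S UNIV "\<lambda>t. laurent_eval q (z t)" "\<lambda>_. 0" 1]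
      hol[OF assms(4)] by (simp add: convex_connected)
  then show False using assms(6) z1 by simp
qed


section \<open>Biregular maps between principal open sets\<close>

definition principal_open :: "'e set \<Rightarrow> 'e laurent \<Rightarrow> ('e \<Rightarrow> complex) set" where
  "principal_open E d = {x \<in> torus E. laurent_eval d x \<noteq> 0}"

text \<open>One fraction has to serve on all of \<open>U\<close>, whereas
  \<open>regular_function\<close> allows local ones; this makes closure under arithmetic and
  substitution a computation without coverings.\<close>

definition fraction_on :: "'e set \<Rightarrow> ('e \<Rightarrow> complex) set \<Rightarrow> (('e \<Rightarrow> complex) \<Rightarrow> complex) \<Rightarrow> bool" where
  "fraction_on E U f \<longleftrightarrow> (\<exists>p\<in>laurent_in E. \<exists>q\<in>laurent_in E.
     \<forall>y\<in>U. laurent_eval q y \<noteq> 0 \<and> f y = laurent_eval p y / laurent_eval q y)"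

lemma fraction_onI:
  assumes "p \<in> laurent_in E" "q \<in> laurent_in E"
    and "\<And>y. y \<in> U \<Longrightarrow> laurent_eval q y \<noteq> 0"
    and "\<And>y. y \<in> U \<Longrightarrow> f y = laurent_eval p y / laurent_eval q y"
  shows "fraction_on E U f"
  using assms unfolding fraction_on_def by blast

lemma fraction_onE:
  assumes "fraction_on E U f"
  obtains p q where "p \<in> laurent_in E" "q \<in> laurent_in E"
    "\<And>y. y \<in> U \<Longrightarrow> laurent_eval q y \<noteq> 0"
    "\<And>y. y \<in> U \<Longrightarrow> f y = laurent_eval p y / laurent_eval q y"
  using assms unfolding fraction_on_def by blast

lemma fraction_on_subset: "fraction_on E U f \<Longrightarrow> V \<subseteq> U \<Longrightarrow> fraction_on E V f"
  unfolding fraction_on_def by blast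

lemma fraction_on_laurent: "p \<in> laurent_in E \<Longrightarrow> fraction_on E U (laurent_eval p)"
  by (rule fraction_onI[of p _ 1]) (auto simp: laurent_in_one laurent_eval_one)

lemma fraction_on_const: "fraction_on E U (\<lambda>_. c)"
  by (rule fraction_onI[of "Poly_Mapping.single 0 c" _ 1])
    (auto simp: laurent_in_const laurent_in_one laurent_eval_one laurent_eval_single
      monomial_eval_def)

lemma fraction_on_coordinate:
  assumes "e \<in> E" shows "fraction_on E U (\<lambda>x. x e)"
  using fraction_on_laurent[OF signed_var_in[OF assms, of 0]]
  by (simp add: laurent_eval_signed_var[abs_def])

lemma fraction_on_add:
  assumes "U \<subseteq> torus E" "fraction_on E U f" "fraction_on E U g"
  shows "fraction_on E U (\<lambda>x. f x + g x)"
proof -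
  obtain p q where pq: "p \<in> laurent_in E" "q \<in> laurent_in E"
    "\<And>y. y \<in> U \<Longrightarrow> laurent_eval q y \<noteq> 0"
    "\<And>y. y \<in> U \<Longrightarrow> f y = laurent_eval p y / laurent_eval q y"
    using assms(2) by (rule fraction_onE) blast
  obtain r s where rs: "r \<in> laurent_in E" "s \<in> laurent_in E"
    "\<And>y. y \<in> U \<Longrightarrow> laurent_eval s y \<noteq> 0"
    "\<And>y. y \<in> U \<Longrightarrow> g y = laurent_eval r y / laurent_eval s y"
    using assms(3) by (rule fraction_onE) blast
  show ?thesis
  proof (rule fraction_onI[of "p * s + r * q" _ "q * s"])
    fix y assume "y \<in> U"
    then have y: "y \<in> torus E" using assms(1) by blast
    show "laurent_eval (q * s) y \<noteq> 0"
      using pq rs \<open>y \<in> U\<close> by (simp add: laurent_eval_mult[OF y])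
    show "f y + g y = laurent_eval (p * s + r * q) y / laurent_eval (q * s) y"
      using pq rs \<open>y \<in> U\<close>
      by (simp add: laurent_eval_mult[OF y] laurent_eval_add field_simps)
  qed (use pq rs in \<open>auto intro: laurent_in_add laurent_in_mult\<close>)
qed

lemma fraction_on_mult:
  assumes "U \<subseteq> torus E" "fraction_on E U f" "fraction_on E U g"
  shows "fraction_on E U (\<lambda>x. f x * g x)"
proof -
  obtain p q where pq: "p \<in> laurent_in E" "q \<in> laurent_in E"
    "\<And>y. y \<in> U \<Longrightarrow> laurent_eval q y \<noteq> 0"
    "\<And>y. y \<in> U \<Longrightarrow> f y = laurent_eval p y / laurent_eval q y"
    using assms(2) by (rule fraction_onE) blast
  obtain r s where rs: "r \<in> laurent_in E" "s \<in> laurent_in E"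
    "\<And>y. y \<in> U \<Longrightarrow> laurent_eval s y \<noteq> 0"
    "\<And>y. y \<in> U \<Longrightarrow> g y = laurent_eval r y / laurent_eval s y"
    using assms(3) by (rule fraction_onE) blast
  show ?thesis
  proof (rule fraction_onI[of "p * r" _ "q * s"])
    fix y assume "y \<in> U"
    then have y: "y \<in> torus E" using assms(1) by blast
    show "laurent_eval (q * s) y \<noteq> 0"
      using pq rs \<open>y \<in> U\<close> by (simp add: laurent_eval_mult[OF y])
    show "f y * g y = laurent_eval (p * r) y / laurent_eval (q * s) y"
      using pq rs \<open>y \<in> U\<close> by (simp add: laurent_eval_mult[OF y])
  qed (use pq rs in \<open>auto intro: laurent_in_mult\<close>)
qed

lemma fraction_on_inverse:
  assumes "fraction_on E U f" "\<And>x. x \<in> U \<Longrightarrow> f x \<noteq> 0"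
  shows "fraction_on E U (\<lambda>x. inverse (f x))"
proof -
  obtain p q where pq: "p \<in> laurent_in E" "q \<in> laurent_in E"
    "\<And>y. y \<in> U \<Longrightarrow> laurent_eval q y \<noteq> 0"
    "\<And>y. y \<in> U \<Longrightarrow> f y = laurent_eval p y / laurent_eval q y"
    using assms(1) by (rule fraction_onE) blast
  then show ?thesis
    using assms(2) by (intro fraction_onI[of q _ p]) simp_all
qed

lemma fraction_on_divide:
  assumes "U \<subseteq> torus E" "fraction_on E U f" "fraction_on E U g" "\<And>x. x \<in> U \<Longrightarrow> g x \<noteq> 0"
  shows "fraction_on E U (\<lambda>x. f x / g x)"
  unfolding divide_inverse using assms by (intro fraction_on_mult fraction_on_inverse)

lemma fraction_on_sum:
  assumes "U \<subseteq> torus E" "\<And>i. i \<in> I \<Longrightarrow> fraction_on E U (f i)"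
  shows "fraction_on E U (\<lambda>x. \<Sum>i\<in>I. f i x)"
  using assms(2)
  by (induction I rule: infinite_finite_induct)
    (auto intro: fraction_on_const fraction_on_add[OF assms(1)])

lemma fraction_on_prod:
  assumes "U \<subseteq> torus E" "\<And>i. i \<in> I \<Longrightarrow> fraction_on E U (f i)"
  shows "fraction_on E U (\<lambda>x. \<Prod>i\<in>I. f i x)"
  using assms(2)
  by (induction I rule: infinite_finite_induct)
    (auto intro: fraction_on_const fraction_on_mult[OF assms(1)])

lemma fraction_on_power_int:
  assumes "U \<subseteq> torus E" "fraction_on E U f" "\<And>x. x \<in> U \<Longrightarrow> f x \<noteq> 0"
  shows "fraction_on E U (\<lambda>x. f x powi k)"
proof -
  have power: "fraction_on E U (\<lambda>x. f x ^ n)" for n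
    by (induction n) (simp_all add: fraction_on_const fraction_on_mult[OF assms(1,2)])
  show ?thesis
  proof (cases "k \<ge> 0")
    case True
    then show ?thesis using power by (simp add: power_int_def)
  next
    case False
    have "fraction_on E U (\<lambda>x. inverse (f x ^ nat (- k)))"
      using assms(3) by (intro fraction_on_inverse power) auto
    with False show ?thesis by (simp add: power_int_def power_inverse)
  qed
qed

text \<open>Evaluation is built from sums, products and integer powers of coordinates; negative
  powers are admissible because \<open>f\<close> takes values in the torus.\<close>

lemma fraction_on_laurent_compose:
  assumes "U \<subseteq> torus E" "f \<in> U \<rightarrow> torus E" "\<And>e. e \<in> E \<Longrightarrow> fraction_on E U (\<lambda>x. f x e)"
    and "p \<in> laurent_in E"
  shows "fraction_on E U (\<lambda>x. laurent_eval p (f x))"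
  unfolding laurent_eval_def
proof (intro fraction_on_sum fraction_on_mult fraction_on_prod fraction_on_power_int
    fraction_on_const assms(1))
  fix m e assume "m \<in> Poly_Mapping.keys p" "e \<in> Poly_Mapping.keys m"
  then have "e \<in> E" using assms(4) by (auto simp: laurent_in_def)
  then show "fraction_on E U (\<lambda>x. f x e)" by (rule assms(3))
  show "f x e \<noteq> 0" if "x \<in> U" for x
    using torus_nonzero[OF _ \<open>e \<in> E\<close>] assms(2) that by blast
qed

text \<open>Substitute \<open>f\<close> into numerator and denominator separately; the denominator
  stays nonzero because \<open>f\<close> maps \<open>U\<close> into \<open>V\<close>.\<close>

lemma fraction_on_compose:
  assumes "U \<subseteq> torus E" "V \<subseteq> torus E" "f \<in> U \<rightarrow> V"
    and "\<And>e. e \<in> E \<Longrightarrow> fraction_on E U (\<lambda>x. f x e)" and "fraction_on E V h"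
  shows "fraction_on E U (\<lambda>x. h (f x))"
proof -
  obtain p q where pq: "p \<in> laurent_in E" "q \<in> laurent_in E"
    "\<And>y. y \<in> V \<Longrightarrow> laurent_eval q y \<noteq> 0"
    "\<And>y. y \<in> V \<Longrightarrow> h y = laurent_eval p y / laurent_eval q y"
    using assms(5) by (rule fraction_onE) blast
  have f: "f \<in> U \<rightarrow> torus E" using assms(2,3) by blast
  have "fraction_on E U (\<lambda>x. laurent_eval p (f x) / laurent_eval q (f x))"
    using pq assms(3) by (intro fraction_on_divide fraction_on_laurent_compose assms f) auto
  then show ?thesis
    using pq(4)[OF funcset_mem[OF assms(3)]] unfolding fraction_on_def by simp
qed

section \<open>Principal open sets\<close>

lemma principal_open_subset: "principal_open E u \<subseteq> torus E"
  by (auto simp: principal_open_def)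

lemma zariski_open_principal_open:
  assumes "u \<in> laurent_in E" shows "zariski_open E (principal_open E u)"
  unfolding zariski_open_def principal_open_def using assms by (intro exI[of _ "{u}"]) auto

text \<open>If \<open>h = p / q\<close>, then \<open>w = u * p\<close> works. Shrinking a domain to
  where a fraction is nonzero thus stays within principal open sets.\<close>

lemma principal_open_nonvanishing:
  assumes "u \<in> laurent_in E" "fraction_on E (principal_open E u) h"
  obtains w where "w \<in> laurent_in E" "principal_open E w = {x \<in> principal_open E u. h x \<noteq> 0}"
proof -
  obtain p q where pq: "p \<in> laurent_in E" "q \<in> laurent_in E"
    "\<And>y. y \<in> principal_open E u \<Longrightarrow> laurent_eval q y \<noteq> 0"
    "\<And>y. y \<in> principal_open E u \<Longrightarrow> h y = laurent_eval p y / laurent_eval q y"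
    using assms(2) by (rule fraction_onE) blast
  have "principal_open E (u * p) = {x \<in> principal_open E u. h x \<noteq> 0}"
    using pq assms(1) by (auto simp: principal_open_def laurent_eval_mult)
  then show ?thesis by (rule that[OF laurent_in_mult[OF assms(1) pq(1)]])
qed

section \<open>Isomorphisms between principal open sets and their composition\<close>

text \<open>Keeping the inverse and exact domains explicit allows pointwise composition. A single
  \<open>E\<close> suffices for source and target since elementary transformations preserve the edge
  set.\<close>

definition biregular where
  "biregular E u v f g \<longleftrightarrow>
     u \<in> laurent_in E \<and> v \<in> laurent_in E \<and> principal_open E u \<noteq> {} \<and>
     f \<in> principal_open E u \<rightarrow> principal_open E v \<and>
     g \<in> principal_open E v \<rightarrow> principal_open E u \<and>
     (\<forall>x\<in>principal_open E u. g (f x) = x) \<and> (\<forall>y\<in>principal_open E v. f (g y) = y) \<and>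
     (\<forall>e\<in>E. fraction_on E (principal_open E u) (\<lambda>x. f x e)) \<and>
     (\<forall>e\<in>E. fraction_on E (principal_open E v) (\<lambda>y. g y e))"

text \<open>The target is nonempty because \<open>f\<close> carries a point of the source into
  it.\<close>

lemma biregular_sym: "biregular E u v f g \<Longrightarrow> biregular E v u g f"
  unfolding biregular_def by blast

lemma biregular_id: "biregular E 1 1 (\<lambda>x. x) (\<lambda>x. x)"
proof -
  have "(\<lambda>e\<in>E. 1) \<in> principal_open E 1"
    by (auto simp: principal_open_def laurent_eval_one torus_def)
  then show ?thesis
    unfolding biregular_def by (auto intro: laurent_in_one fraction_on_coordinate)
qed

lemma biregularD:
  assumes "biregular E u v f g"
  shows "u \<in> laurent_in E" "principal_open E u \<noteq> {}"
    and "\<And>x. x \<in> principal_open E u \<Longrightarrow> f x \<in> principal_open E v"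
    and "\<And>x. x \<in> principal_open E u \<Longrightarrow> g (f x) = x"
    and "\<And>e. e \<in> E \<Longrightarrow> fraction_on E (principal_open E u) (\<lambda>x. f x e)"
  using assms unfolding biregular_def by auto

text \<open>The function \<open>w\<close> composed with \<open>f\<close> is a fraction, so its
  nonvanishing locus is principal; it is nonempty by irreducibility of the torus.\<close>

lemma biregular_pullback:
  assumes f: "biregular E u v f g" and w: "w \<in> laurent_in E" "principal_open E w \<noteq> {}"
  obtains d where "d \<in> laurent_in E" "principal_open E d \<noteq> {}"
    "principal_open E d = {x \<in> principal_open E u. f x \<in> principal_open E w}"
proof -
  note d = biregularD[OF f] and i = biregularD[OF biregular_sym[OF f]]
  have f_torus: "f x \<in> torus E" if "x \<in> principal_open E u" for x
    using d(3)[OF that] principal_open_subset by (rule rev_subsetD)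
  have "fraction_on E (principal_open E u) (\<lambda>x. laurent_eval w (f x))"
    using f_torus by (intro fraction_on_laurent_compose principal_open_subset d w) auto
  then obtain r where r: "r \<in> laurent_in E"
    "principal_open E r = {x \<in> principal_open E u. laurent_eval w (f x) \<noteq> 0}"
    by (rule principal_open_nonvanishing[OF d(1)])
  then have eq: "principal_open E r = {x \<in> principal_open E u. f x \<in> principal_open E w}"
    using f_torus by (simp add: principal_open_def[of E w] cong: conj_cong)
  obtain x y where "x \<in> principal_open E v" "y \<in> principal_open E w"
    using i(2) w(2) by blast
  \<comment> \<open>The principal open sets of \<open>v\<close> and \<open>w\<close> are nonempty,
    so they meet; \<open>g\<close> carries a common point back into the preimage.\<close>
  then obtain z where z: "z \<in> principal_open E v" "z \<in> principal_open E w"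
    using torus_irreducible[of x E y v w] i(1) w(1) by (auto simp: principal_open_def)
  have "g z \<in> principal_open E r"
    unfolding eq using i(3,4)[OF z(1)] z(2) by simp
  then have "principal_open E r \<noteq> {}" by blast
  then show ?thesis using eq by (rule that[OF r(1)])
qed

text \<open>The source shrinks to the preimage of the domain of \<open>f2\<close> under
  \<open>f1\<close>, the target to the preimage of the domain of \<open>g1\<close> under
  \<open>g2\<close>. The two inclusions keep identities known on the old domains available.\<close>

lemma biregular_compose:
  assumes f1: "biregular E u1 v1 f1 g1" and f2: "biregular E u2 v2 f2 g2"
  obtains u v where "biregular E u v (\<lambda>x. f2 (f1 x)) (\<lambda>y. g1 (g2 y))"
    "principal_open E u \<subseteq> principal_open E u1" "f1 ` principal_open E u \<subseteq> principal_open E u2"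
proof -
  note d1 = biregularD[OF f1] and i1 = biregularD[OF biregular_sym[OF f1]]
    and d2 = biregularD[OF f2] and i2 = biregularD[OF biregular_sym[OF f2]]
  obtain u where u: "u \<in> laurent_in E" "principal_open E u \<noteq> {}"
    "principal_open E u = {x \<in> principal_open E u1. f1 x \<in> principal_open E u2}"
    by (rule biregular_pullback[OF f1 d2(1,2)])
  obtain v where v: "v \<in> laurent_in E" "principal_open E v \<noteq> {}"
    "principal_open E v = {y \<in> principal_open E v2. g2 y \<in> principal_open E v1}"
    by (rule biregular_pullback[OF biregular_sym[OF f2] i1(1,2)])
  have "biregular E u v (\<lambda>x. f2 (f1 x)) (\<lambda>y. g1 (g2 y))"
    unfolding biregular_def
  proof (intro conjI ballI funcsetI)
    fix x assume "x \<in> principal_open E u"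
    then have x: "x \<in> principal_open E u1" "f1 x \<in> principal_open E u2"
      by (simp_all add: u(3))
    then show "g1 (g2 (f2 (f1 x))) = x" by (simp add: d1 d2)
    show "f2 (f1 x) \<in> principal_open E v"
      unfolding v(3) using x by (simp add: d1 d2)
  next
    fix y assume "y \<in> principal_open E v"
    then have y: "y \<in> principal_open E v2" "g2 y \<in> principal_open E v1"
      by (simp_all add: v(3))
    then show "f2 (f1 (g1 (g2 y))) = y" by (simp add: i1 i2)
    show "g1 (g2 y) \<in> principal_open E u"
      unfolding u(3) using y by (simp add: i1 i2)
  next
    fix e assume e: "e \<in> E"
    show "fraction_on E (principal_open E u) (\<lambda>x. f2 (f1 x) e)"
    proof (rule fraction_on_compose[OF principal_open_subset principal_open_subset,
          where f = f1 and h = "\<lambda>y. f2 y e"])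
      show "f1 \<in> principal_open E u \<rightarrow> principal_open E u2" by (simp add: u(3))
      show "fraction_on E (principal_open E u) (\<lambda>x. f1 x i)" if "i \<in> E" for i
        using d1(5)[OF that] by (rule fraction_on_subset) (simp add: u(3))
    qed (rule d2(5)[OF e])
    show "fraction_on E (principal_open E v) (\<lambda>y. g1 (g2 y) e)"
    proof (rule fraction_on_compose[OF principal_open_subset principal_open_subset,
          where f = g2 and h = "\<lambda>x. g1 x e"])
      show "g2 \<in> principal_open E v \<rightarrow> principal_open E v1" by (simp add: v(3))
      show "fraction_on E (principal_open E v) (\<lambda>x. g2 x i)" if "i \<in> E" for i
        using i2(5)[OF that] by (rule fraction_on_subset) (simp add: v(3))
    qed (rule i1(5)[OF e])
  qed (rule u v)+
  then show ?thesis by (rule that) (auto simp: u(3))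
qed

section \<open>From biregular to birational maps\<close>

lemma biregular_rational_map:
  assumes "biregular E u v f g" shows "rational_map E E (principal_open E u) f"
  unfolding rational_map_def
proof (intro conjI ballI funcsetI)
  note d = biregularD[OF assms]
  show U: "zariski_open E (principal_open E u)"
    by (rule zariski_open_principal_open[OF d(1)])
  show "principal_open E u \<noteq> {}" by (rule d(2))
  show "f x \<in> torus E" if "x \<in> principal_open E u" for x
    using d(3)[OF that] principal_open_subset by (rule rev_subsetD)
  show "regular_function E (principal_open E u) (\<lambda>x. f x e)" if "e \<in> E" for e
    unfolding regular_function_def
  proof
    fix x assume "x \<in> principal_open E u"
    moreover obtain p q where "p \<in> laurent_in E" "q \<in> laurent_in E"
      "\<And>y. y \<in> principal_open E u \<Longrightarrow> laurent_eval q y \<noteq> 0"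
      "\<And>y. y \<in> principal_open E u \<Longrightarrow> f y e = laurent_eval p y / laurent_eval q y"
      using d(5)[OF \<open>e \<in> E\<close>] by (rule fraction_onE) blast
    ultimately show "\<exists>V p q. zariski_open E V \<and> x \<in> V \<and> V \<subseteq> principal_open E u \<and>
        p \<in> laurent_in E \<and> q \<in> laurent_in E \<and>
        (\<forall>y\<in>V. laurent_eval q y \<noteq> 0 \<and> f y e = laurent_eval p y / laurent_eval q y)"
      \<comment> \<open>The fraction is global, so the whole domain is a valid neighbourhood of each
        point.\<close>
      using U by (intro exI[of _ "principal_open E u"] exI[of _ p] exI[of _ q]) simp
  qed
qed

text \<open>The image of \<open>f\<close> is the whole principal open set of \<open>v\<close>, which
  meets every nonempty open set by irreducibility.\<close>

lemma biregular_dominant: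
  assumes "biregular E u v f g" shows "dominant E (principal_open E u) f"
  unfolding dominant_def
proof (intro allI impI)
  note i = biregularD[OF biregular_sym[OF assms]]
  fix W assume "zariski_open E W \<and> W \<noteq> {}"
  then obtain S where S: "S \<subseteq> laurent_in E" "W = {x \<in> torus E. \<exists>p\<in>S. laurent_eval p x \<noteq> 0}"
    and "W \<noteq> {}" unfolding zariski_open_def by blast
  \<comment> \<open>One member \<open>p\<close> of \<open>S\<close> is enough: its nonvanishing
    locus is a nonempty subset of \<open>W\<close>.\<close>
  then obtain w p where w: "w \<in> torus E" "p \<in> S" "laurent_eval p w \<noteq> 0" by blast
  obtain y where "y \<in> principal_open E v" using i(2) by blast
  then obtain z where z: "z \<in> principal_open E v" "laurent_eval p z \<noteq> 0"
    using torus_irreducible[of w E y p v] w S(1) i(1) by (auto simp: principal_open_def)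
  then have "z \<in> W"
    unfolding S(2) using w(2) principal_open_subset by blast
  moreover have "z \<in> f ` principal_open E u"
    using i(3,4)[OF z(1)] by (intro image_eqI[of _ _ "g z"]) simp_all
  ultimately show "f ` principal_open E u \<inter> W \<noteq> {}" by blast
qed

lemma biregular_birational_map:
  assumes "biregular E u v f g" shows "birational_map E E (principal_open E u) f"
  unfolding birational_map_def
proof (intro conjI exI)
  note inv = biregular_sym[OF assms]
  show "rational_map E E (principal_open E u) f" "dominant E (principal_open E u) f"
    "rational_map E E (principal_open E v) g" "dominant E (principal_open E v) g"
    using assms inv by (simp_all only: biregular_rational_map biregular_dominant)
  show "\<forall>x\<in>principal_open E u. f x \<in> principal_open E v \<longrightarrow> g (f x) = x"
    "\<forall>y\<in>principal_open E v. g y \<in> principal_open E u \<longrightarrow> f (g y) = y"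
    using assms by (simp_all add: biregular_def)
qed


section \<open>Elementary transformations\<close>

text \<open>The coefficient of \<open>x\<close> in the potential of a vertex of color
  \<open>k\<close> with variables \<open>x\<close>, \<open>a\<close>, \<open>b\<close>. Flipping the
  sign at \<open>x\<close> changes the parity, so the coefficient of \<open>inverse x\<close> is
  \<open>edge_coeff (k + 1) a b\<close>.\<close>

definition edge_coeff :: "bit \<Rightarrow> complex \<Rightarrow> complex \<Rightarrow> complex" where
  "edge_coeff k a b = (if k = 0 then a * b + inverse (a * b) else a / b + b / a)"

text \<open>The sign pairs with sum \<open>k\<close> are \<open>(0, k)\<close> and
  \<open>(1, k + 1)\<close>, which treats both colors uniformly.\<close>

definition edge_coeff_laurent :: "bit \<Rightarrow> 'e \<Rightarrow> 'e \<Rightarrow> 'e laurent" where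
  "edge_coeff_laurent k i j =
     signed_var i 0 * signed_var j k + signed_var i 1 * signed_var j (k + 1)"

lemma edge_coeff_laurent_in: "i \<in> E \<Longrightarrow> j \<in> E \<Longrightarrow> edge_coeff_laurent k i j \<in> laurent_in E"
  unfolding edge_coeff_laurent_def by (intro laurent_in_add laurent_in_mult signed_var_in)

lemma laurent_eval_edge_coeff:
  assumes "x \<in> torus E" "i \<in> E" "j \<in> E"
  shows "laurent_eval (edge_coeff_laurent k i j) x = edge_coeff k (x i) (x j)"
  using assms by (cases k)
    (simp_all add: edge_coeff_laurent_def edge_coeff_def laurent_eval_add laurent_eval_mult
      signed_var_in laurent_eval_signed_var field_simps)

text \<open>
  For colors 0 both sides are \<open>(ab + cd) (ac + bd) (ad + bc) (abcd + 1) / (abcd)\<^sup>2\<close>; the other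
  colors reduce to this by inverting variables.
\<close>

lemma edge_coeff_exchange:
  assumes "a \<noteq> 0" "b \<noteq> 0" "c \<noteq> 0" "d \<noteq> 0"
  shows "(edge_coeff k a b + edge_coeff l c d) * (edge_coeff (k + 1) a b + edge_coeff (l + 1) c d) =
    (edge_coeff k a c + edge_coeff l b d) * (edge_coeff (k + 1) a c + edge_coeff (l + 1) b d)"
proof -
  have factor: "(edge_coeff 0 a b + edge_coeff 0 c d) * (edge_coeff 1 a b + edge_coeff 1 c d) =
      (a * b + c * d) * (a * c + b * d) * (a * d + b * c) * (a * b * c * d + 1) / (a * b * c * d)\<^sup>2"
    if nz: "a \<noteq> 0" "b \<noteq> 0" "c \<noteq> 0" "d \<noteq> 0" for a b c d
  proof -
    have "edge_coeff 0 a b + edge_coeff 0 c d =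
        (a * b + c * d) * (a * b * c * d + 1) / (a * b * c * d)"
      using nz by (simp add: edge_coeff_def divide_simps) (simp add: algebra_simps)
    moreover have "edge_coeff 1 a b + edge_coeff 1 c d =
        (a * c + b * d) * (a * d + b * c) / (a * b * c * d)"
      using nz by (simp add: edge_coeff_def divide_simps) (simp add: algebra_simps)
    ultimately show ?thesis by (simp add: power2_eq_square mult_ac)
  qed
  have exch0: "(edge_coeff 0 a b + edge_coeff 0 c d) * (edge_coeff 1 a b + edge_coeff 1 c d) =
      (edge_coeff 0 a c + edge_coeff 0 b d) * (edge_coeff 1 a c + edge_coeff 1 b d)"
    if "a \<noteq> 0" "b \<noteq> 0" "c \<noteq> 0" "d \<noteq> 0" for a b c d
    \<comment> \<open>The factored form is symmetric under exchanging \<open>b\<close> and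
      \<open>c\<close>.\<close>
    unfolding factor[OF that] factor[OF that(1,3,2,4)] by (simp add: mult_ac add.commute)
  have inv: "edge_coeff m (inverse x) y = edge_coeff (m + 1) x y"
    "edge_coeff m y (inverse x) = edge_coeff (m + 1) y x" for m x y
    by (cases m; simp add: edge_coeff_def field_simps)+
  \<comment> \<open>On both sides \<open>a\<close> occurs only in terms with \<open>k\<close> and
    \<open>d\<close> only in terms with \<open>l\<close>. Hence inverting \<open>a\<close> shifts
    \<open>k\<close>, inverting \<open>d\<close> shifts \<open>l\<close>, and all four color pairs
    reduce to \<open>exch0\<close>.\<close>
  show ?thesis
    using assms exch0[of a b c d] exch0[of a b c "inverse d"] exch0[of "inverse a" b c d]
      exch0[of "inverse a" b c "inverse d"]
    by (cases k; cases l) (simp_all add: inv mult.commute)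
qed

section \<open>Vertex potentials split along one half-edge\<close>

lemma laurent_eval_vertex_potential:
  assumes "x \<in> torus E" "\<And>h. h \<in> halves_at G v \<Longrightarrow> edge_of G h \<in> E"
  shows "laurent_eval (vertex_potential G v) x =
    (\<Sum>s \<in> {s \<in> halves_at G v \<rightarrow>\<^sub>E UNIV. (\<Sum>h\<in>halves_at G v. s h) = color G v}.
        \<Prod>h\<in>halves_at G v. if s h = 0 then x (edge_of G h) else inverse (x (edge_of G h)))"
  unfolding vertex_potential_def laurent_eval_sum using assms
  by (intro sum.cong refl)
    (simp add: laurent_eval_prod[of x E] signed_var_in laurent_eval_signed_var)

text \<open>Applied three times, this turns the sum over sign functions at a vertex into a triple
  sum over bits.\<close>

lemma sum_PiE_insert:
  assumes "a \<notin> A"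
  shows "(\<Sum>s\<in>insert a A \<rightarrow>\<^sub>E B. F s) = (\<Sum>b\<in>B. \<Sum>s\<in>A \<rightarrow>\<^sub>E B. F (s(a := b)))"
proof -
  have "(\<Sum>s\<in>insert a A \<rightarrow>\<^sub>E B. F s) = (\<Sum>(b, s)\<in>B \<times> (A \<rightarrow>\<^sub>E B). F (s(a := b)))"
    unfolding PiE_insert_eq using inj_combinator[OF assms, of "\<lambda>_. B"]
    by (subst sum.reindex) (auto simp: case_prod_unfold)
  then show ?thesis by (simp add: sum.cartesian_product)
qed

text \<open>Split the sum by the sign at \<open>h1\<close>. Only the half-edges are distinct; their
  edges may coincide, so loops are covered.\<close>

lemma laurent_eval_trivalent_vertex:
  assumes "x \<in> torus E" "halves_at G v = {h1, h2, h3}" "distinct [h1, h2, h3]"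
    and "edge_of G h1 = i" "edge_of G h2 = j" "edge_of G h3 = k" "i \<in> E" "j \<in> E" "k \<in> E"
  shows "laurent_eval (vertex_potential G v) x =
    x i * edge_coeff (color G v) (x j) (x k) + edge_coeff (color G v + 1) (x j) (x k) / x i"
proof -
  have U: "(UNIV :: bit set) = {0, 1}" using bit.exhaust by auto
  let ?F = "\<lambda>s. \<Prod>h\<in>{h1, h2, h3}. if s h = 0 then x (edge_of G h) else inverse (x (edge_of G h))"
  have "laurent_eval (vertex_potential G v) x =
      (\<Sum>s \<in> {s \<in> {h1, h2, h3} \<rightarrow>\<^sub>E UNIV. (\<Sum>h\<in>{h1, h2, h3}. s h) = color G v}. ?F s)"
    using assms by (subst laurent_eval_vertex_potential[of x E]) auto
  \<comment> \<open>Moving the parity condition into the summand leaves a full function space as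
    index set, which can be split argument by argument.\<close>
  also have "\<dots> = (\<Sum>s \<in> {h1, h2, h3} \<rightarrow>\<^sub>E UNIV.
      if (\<Sum>h\<in>{h1, h2, h3}. s h) = color G v then ?F s else 0)"
    by (intro sum.inter_filter finite_PiE) (auto simp: U)
  also have "\<dots> = (\<Sum>b1\<in>UNIV. \<Sum>b2\<in>UNIV. \<Sum>b3\<in>UNIV. if b1 + (b2 + b3) = color G v
      then (if b1 = 0 then x i else inverse (x i)) * ((if b2 = 0 then x j else inverse (x j)) *
        (if b3 = 0 then x k else inverse (x k))) else 0)"
  proof -
    have notin: "h1 \<notin> {h2, h3}" "h2 \<notin> {h3}" "h3 \<notin> {}"
      and "h2 \<noteq> h1" "h3 \<noteq> h1" "h3 \<noteq> h2"
      using assms(3) by auto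
    then show ?thesis
      unfolding notin[THEN sum_PiE_insert] PiE_empty_domain
      by (simp add: assms(4-6) cong: if_cong)
  qed
  also have "\<dots> = x i * edge_coeff (color G v) (x j) (x k) +
      edge_coeff (color G v + 1) (x j) (x k) / x i"
    by (cases "color G v") (simp_all add: U edge_coeff_def divide_inverse algebra_simps)
  finally show ?thesis .
qed

section \<open>The coordinate change for one elementary transformation\<close>

text \<open>An invariant to be carried along a sequence of transformations.\<close>

definition finite_graph :: "('v, 'h, 'e) colored_graph \<Rightarrow> bool" where
  "finite_graph G \<longleftrightarrow> finite (verts G) \<and> edge_of G \<in> halves G \<rightarrow> edges G"

lemma elementary_transformation_finite_graph:
  "elementary_transformation G G' \<Longrightarrow> finite_graph G \<Longrightarrow> finite_graph G'"
  unfolding elementary_transformation_def finite_graph_def by (auto simp: Pi_iff)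

text \<open>Since \<open>p\<close> and \<open>q\<close> do not see coordinate \<open>e\<close>, the
  factor \<open>p / q\<close> is unchanged by the rescaling, so rescaling by \<open>q / p\<close>
  undoes it on the same domain.\<close>

lemma biregular_rescale:
  assumes e: "e \<in> E" and p: "p \<in> laurent_in E" and q: "q \<in> laurent_in E"
    and ne: "principal_open E (p * q) \<noteq> {}"
    and p_indep: "\<And>x t. x \<in> torus E \<Longrightarrow> t \<noteq> 0 \<Longrightarrow> laurent_eval p (x(e := t)) = laurent_eval p x"
    and q_indep: "\<And>x t. x \<in> torus E \<Longrightarrow> t \<noteq> 0 \<Longrightarrow> laurent_eval q (x(e := t)) = laurent_eval q x"
  shows "biregular E (p * q) (p * q)
    (\<lambda>x. x(e := x e * laurent_eval p x / laurent_eval q x))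
    (\<lambda>x. x(e := x e * laurent_eval q x / laurent_eval p x))"
proof -
  let ?U = "principal_open E (p * q)"
  have U: "?U = {x \<in> torus E. laurent_eval p x \<noteq> 0 \<and> laurent_eval q x \<noteq> 0}"
    using p q by (auto simp: principal_open_def laurent_eval_mult)
  have upd: "x(e := t) \<in> torus E" if "x \<in> torus E" "t \<noteq> 0" for x t
    using that e by (auto simp: torus_def PiE_iff extensional_def)
  have nz: "x e \<noteq> 0" if "x \<in> ?U" for x
    using that torus_nonzero[OF _ e] by (simp add: U)
  have U_D: "x \<in> torus E" "laurent_eval p x \<noteq> 0" "laurent_eval q x \<noteq> 0" "x e \<noteq> 0" if "x \<in> ?U" for x
    using that nz by (simp_all add: U)
  have frac: "fraction_on E ?U (\<lambda>x. (x(e := x e * laurent_eval r x / laurent_eval s x)) i)"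
    if "i \<in> E" "r \<in> laurent_in E" "s \<in> laurent_in E" "\<And>x. x \<in> ?U \<Longrightarrow> laurent_eval s x \<noteq> 0" for r s i
  proof (cases "i = e")
    case True
    have "fraction_on E ?U (\<lambda>x. x e * laurent_eval r x / laurent_eval s x)"
      by (rule fraction_on_divide[OF principal_open_subset fraction_on_mult[OF principal_open_subset
            fraction_on_coordinate[OF e] fraction_on_laurent[OF that(2)]]
          fraction_on_laurent[OF that(3)] that(4)])
    with True show ?thesis by simp
  next
    case False
    with fraction_on_coordinate[OF that(1)] show ?thesis by simp
  qed
  show ?thesis
    unfolding biregular_def
  proof (intro conjI ballI funcsetI)
    show "p * q \<in> laurent_in E" "p * q \<in> laurent_in E"
      using p q by (rule laurent_in_mult)+
    show "?U \<noteq> {}" by (rule ne)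
  next
    fix x assume "x \<in> ?U"
    note x = U_D[OF this]
    have ne: "x e * laurent_eval p x / laurent_eval q x \<noteq> 0"
      "x e * laurent_eval q x / laurent_eval p x \<noteq> 0"
      using x by simp_all
    show "x(e := x e * laurent_eval p x / laurent_eval q x) \<in> ?U"
      "x(e := x e * laurent_eval q x / laurent_eval p x) \<in> ?U"
      using ne[THEN upd[OF x(1)]] x(2,3)
      by (simp_all only: U mem_Collect_eq ne[THEN p_indep[OF x(1)]] ne[THEN q_indep[OF x(1)]]
          simp_thms)
    let ?f = "x(e := x e * laurent_eval p x / laurent_eval q x)"
      and ?g = "x(e := x e * laurent_eval q x / laurent_eval p x)"
    show "?f(e := ?f e * laurent_eval q ?f / laurent_eval p ?f) = x"
      "?g(e := ?g e * laurent_eval p ?g / laurent_eval q ?g) = x"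
      unfolding ne[THEN p_indep[OF x(1)]] ne[THEN q_indep[OF x(1)]]
      using x(2,3) by simp_all
  next
    fix i assume i: "i \<in> E"
    show "fraction_on E ?U (\<lambda>x. (x(e := x e * laurent_eval p x / laurent_eval q x)) i)"
      by (rule frac[OF i p q U_D(3)])
    show "fraction_on E ?U (\<lambda>x. (x(e := x e * laurent_eval q x / laurent_eval p x)) i)"
      by (rule frac[OF i q p U_D(2)])
  qed
qed

text \<open>Vertices other than \<open>v1\<close> and \<open>v2\<close> keep their half-edges and do
  not meet \<open>e\<close>, so only these two potentials are affected by the move and the
  rescaling.\<close>

lemma elementary_transformation_biregular:
  assumes el: "elementary_transformation G G'" and fin: "finite_graph G"
  obtains u v f g where "biregular (edges G) u v f g"
    "\<And>x. x \<in> principal_open (edges G) u \<Longrightarrow>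
      laurent_eval (graph_potential G') (f x) = laurent_eval (graph_potential G) x"
proof -
  define E where "E = edges G"
  from el obtain e v1 v2 h1 h2 ha hb hc hd where
    same: "verts G' = verts G" "halves G' = halves G"
      "\<forall>h\<in>halves G. edge_of G' h = edge_of G h" "\<forall>v\<in>verts G. color G' v = color G v"
    and e: "e \<in> E" and v: "v1 \<in> verts G" "v2 \<in> verts G" "v1 \<noteq> v2"
    and dist: "distinct [h1, h2, ha, hb, hc, hd]"
    and he: "halves_in G e = {h1, h2}"
    and at: "halves_at G v1 = {h1, ha, hb}" "halves_at G v2 = {h2, hc, hd}"
    and at': "halves_at G' v1 = {h1, ha, hc}" "halves_at G' v2 = {h2, hb, hd}"
    and other: "\<forall>h\<in>halves G - {h1, h2, ha, hb, hc, hd}. vert_of G' h = vert_of G h"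
    unfolding elementary_transformation_def E_def by (elim conjE exE) blast
  have halves: "{h1, h2, ha, hb, hc, hd} \<subseteq> halves G"
    using at unfolding halves_at_def by blast
  have edge_in: "edge_of G h \<in> E" if "h \<in> halves G" for h
    using fin that by (auto simp: finite_graph_def E_def)
  have edge_eq: "edge_of G h = e \<longleftrightarrow> h \<in> {h1, h2}" if "h \<in> halves G" for h
    using he that unfolding halves_in_def by blast
  define a b c d where "a = edge_of G ha" and "b = edge_of G hb" and "c = edge_of G hc"
    and "d = edge_of G hd"
  note abcd_def = a_def b_def c_def d_def
  \<comment> \<open>The halves of \<open>e\<close> are exactly \<open>h1\<close> and
    \<open>h2\<close>, so the other four half-edges avoid \<open>e\<close>, though \<open>a\<close>,
    \<open>b\<close>, \<open>c\<close>, \<open>d\<close> may coincide among themselves.\<close>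
  have abcd: "a \<in> E" "b \<in> E" "c \<in> E" "d \<in> E" "a \<noteq> e" "b \<noteq> e" "c \<noteq> e" "d \<noteq> e"
    using halves edge_in edge_eq dist by (auto simp: abcd_def)
  have h12: "edge_of G h1 = e" "edge_of G h2 = e" using halves edge_eq by auto
  define k l where "k = color G v1" and "l = color G v2"
  \<comment> \<open>The total coefficients of \<open>x e\<close> at \<open>v1\<close> and
    \<open>v2\<close>: \<open>p\<close> before the move, \<open>q\<close> after it.\<close>
  define p where "p = edge_coeff_laurent k a b + edge_coeff_laurent l c d"
  define q where "q = edge_coeff_laurent k a c + edge_coeff_laurent l b d"
  have pq: "p \<in> laurent_in E" "q \<in> laurent_in E"
    using abcd by (auto simp: p_def q_def intro!: laurent_in_add edge_coeff_laurent_in)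
  have p_eval: "laurent_eval p x = edge_coeff k (x a) (x b) + edge_coeff l (x c) (x d)"
    and q_eval: "laurent_eval q x = edge_coeff k (x a) (x c) + edge_coeff l (x b) (x d)"
    if "x \<in> torus E" for x
    using that abcd by (simp_all add: p_def q_def laurent_eval_add laurent_eval_edge_coeff)
  have upd: "x(e := t) \<in> torus E" if "x \<in> torus E" "t \<noteq> 0" for x t
    using that e by (auto simp: torus_def PiE_iff extensional_def)
  \<comment> \<open>At the all-ones point every \<open>edge_coeff\<close> is 2, so \<open>p\<close>
    and \<open>q\<close> both take the value 4.\<close>
  have "(\<lambda>i\<in>E. 1) \<in> torus E" by (auto simp: torus_def)
  then have "(\<lambda>i\<in>E. 1) \<in> principal_open E (p * q)"
    using pq abcd by (simp add: principal_open_def laurent_eval_mult p_eval q_eval edge_coeff_def)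
  then have ne: "principal_open E (p * q) \<noteq> {}" by blast
  define f where "f x = x(e := x e * laurent_eval p x / laurent_eval q x)" for x
  define g where "g x = x(e := x e * laurent_eval q x / laurent_eval p x)" for x
  have bireg: "biregular E (p * q) (p * q) f g"
    unfolding f_def[abs_def] g_def[abs_def]
    by (rule biregular_rescale[OF e pq ne]) (simp_all add: p_eval q_eval upd abcd)
  have "laurent_eval (graph_potential G') (f x) = laurent_eval (graph_potential G) x"
    if "x \<in> principal_open E (p * q)" for x
  proof -
    have x: "x \<in> torus E" and fx: "f x \<in> torus E"
      using that biregularD(3)[OF bireg that] principal_open_subset[of E "p * q"]
      by (simp_all add: subset_iff)
    have nz: "laurent_eval p x \<noteq> 0" "laurent_eval q x \<noteq> 0"
      using that x pq by (auto simp: principal_open_def laurent_eval_mult)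
    have xnz: "x e \<noteq> 0" "x a \<noteq> 0" "x b \<noteq> 0" "x c \<noteq> 0" "x d \<noteq> 0"
      using torus_nonzero[OF x] e abcd by auto
    have f_other: "f x i = x i" if "i \<noteq> e" for i using that by (simp add: f_def)
    let ?W = "\<lambda>v. laurent_eval (vertex_potential G v) x"
      and ?W' = "\<lambda>v. laurent_eval (vertex_potential G' v) (f x)"
    have W: "?W v = ?W' v" if "v \<in> verts G - {v1, v2}" for v
    proof -
      let ?H = "{h1, h2, ha, hb, hc, hd}"
      have "?H = halves_at G v1 \<union> halves_at G v2" "?H = halves_at G' v1 \<union> halves_at G' v2"
        unfolding at at' by auto
      \<comment> \<open>The six half-edges are exactly those at \<open>v1\<close> or
        \<open>v2\<close>, both before and after the move, so none of them is at another
        vertex.\<close>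
      then have not_six: "halves_at G v \<inter> ?H = {}" "halves_at G' v \<inter> ?H = {}"
        using that by (auto simp only: halves_at_def)
      have eq: "halves_at G' v = halves_at G v"
      proof (intro equalityI subsetI)
        fix h assume "h \<in> halves_at G' v"
        moreover from this have "h \<in> halves G - ?H"
          using not_six(2) same(2) by (simp add: halves_at_def disjoint_iff)
        ultimately show "h \<in> halves_at G v"
          using other by (simp add: halves_at_def)
      next
        fix h assume "h \<in> halves_at G v"
        moreover from this have "h \<in> halves G - ?H"
          using not_six(1) by (simp add: halves_at_def disjoint_iff)
        ultimately show "h \<in> halves_at G' v"
          using other same(2) by (simp add: halves_at_def)
      qed
      have edges: "edge_of G' h = edge_of G h \<and> edge_of G h \<in> E - {e}" if "h \<in> halves_at G v" for h
      proof -
        have "h \<in> halves G" "h \<notin> ?H"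
          using that not_six(1) by (simp_all add: halves_at_def disjoint_iff)
        then show ?thesis using same(3) edge_in[of h] edge_eq[of h] by simp
      qed
      then have prods: "(\<Prod>h\<in>halves_at G v.
            if s h = 0 then f x (edge_of G' h) else inverse (f x (edge_of G' h))) =
          (\<Prod>h\<in>halves_at G v. if s h = 0 then x (edge_of G h) else inverse (x (edge_of G h)))" for s
        by (intro prod.cong refl) (auto simp: f_other)
      show ?thesis
        using edges same(4) that
        by (subst (1 2) laurent_eval_vertex_potential[of _ E]) (auto simp: x fx eq prods)
    qed
    have distinct3: "distinct [h1, ha, hb]" "distinct [h2, hc, hd]" "distinct [h1, ha, hc]"
      "distinct [h2, hb, hd]"
      using dist by simp_all
    have edges': "edge_of G' h1 = e" "edge_of G' h2 = e" "edge_of G' ha = a" "edge_of G' hb = b"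
      "edge_of G' hc = c" "edge_of G' hd = d"
      using same(3) halves h12 by (simp_all add: abcd_def)
    have colors': "color G' v1 = k" "color G' v2 = l"
      using same(4) v by (simp_all add: k_def l_def)
    note vertex = laurent_eval_trivalent_vertex[OF x] and vertex' = laurent_eval_trivalent_vertex[OF fx]
    have v_pot: "?W v1 = x e * edge_coeff k (x a) (x b) + edge_coeff (k + 1) (x a) (x b) / x e"
      "?W v2 = x e * edge_coeff l (x c) (x d) + edge_coeff (l + 1) (x c) (x d) / x e"
      unfolding k_def l_def
      by (rule vertex[OF at(1) distinct3(1) h12(1) a_def[symmetric] b_def[symmetric] e abcd(1,2)],
          rule vertex[OF at(2) distinct3(2) h12(2) c_def[symmetric] d_def[symmetric] e abcd(3,4)])
    have v_pot':
      "?W' v1 = f x e * edge_coeff k (x a) (x c) + edge_coeff (k + 1) (x a) (x c) / f x e"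
      "?W' v2 = f x e * edge_coeff l (x b) (x d) + edge_coeff (l + 1) (x b) (x d) / f x e"
      using vertex'[OF at'(1) distinct3(3) edges'(1,3,5) e abcd(1,3)]
        vertex'[OF at'(2) distinct3(4) edges'(2,4,6) e abcd(2,4)]
      by (simp_all only: colors' abcd f_other not_False_eq_True)
    \<comment> \<open>The values at \<open>x\<close> of the total coefficients of the inverse edge
      variable, before and after.\<close>
    define p' where "p' = edge_coeff (k + 1) (x a) (x b) + edge_coeff (l + 1) (x c) (x d)"
    define q' where "q' = edge_coeff (k + 1) (x a) (x c) + edge_coeff (l + 1) (x b) (x d)"
    have exch: "laurent_eval p x * p' = laurent_eval q x * q'"
      unfolding p_eval[OF x] q_eval[OF x] p'_def q'_def using xnz by (intro edge_coeff_exchange)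
    have "?W v1 + ?W v2 = x e * laurent_eval p x + p' / x e"
      unfolding v_pot p_eval[OF x] p'_def by (simp add: algebra_simps add_divide_distrib)
    \<comment> \<open>Here the exchange identity enters; the terms linear in the edge variable match
      by the choice of \<open>f\<close> alone.\<close>
    also have "p' / x e = q' / f x e"
      using exch nz xnz by (simp add: f_def field_simps)
    also have "x e * laurent_eval p x = f x e * laurent_eval q x"
      using nz by (simp add: f_def)
    also have "f x e * laurent_eval q x + q' / f x e = ?W' v1 + ?W' v2"
      unfolding v_pot' q_eval[OF x] q'_def by (simp add: algebra_simps add_divide_distrib)
    finally have W12: "?W v1 + ?W v2 = ?W' v1 + ?W' v2" .
    have split: "(\<Sum>v\<in>verts G. F v) = F v1 + F v2 + (\<Sum>v\<in>verts G - {v1, v2}. F v)"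
      for F :: "'a \<Rightarrow> complex"
      using fin v sum.subset_diff[of "{v1, v2}" "verts G" F]
      by (simp add: finite_graph_def add.commute)
    show ?thesis
      unfolding graph_potential_def laurent_eval_sum same(1) split W12
      by (simp only: sum.cong[OF refl W])
  qed
  with bireg show ?thesis using that unfolding E_def by blast
qed

section \<open>Finite sequences of elementary transformations\<close>

text \<open>The edge set is constant along the sequence, so all coordinate changes live on one torus
  and compose.\<close>

lemma elementary_transformations_biregular:
  assumes "elementary_transformation\<^sup>*\<^sup>* G G'" "finite_graph G"
  shows "finite_graph G' \<and> edges G' = edges G \<and>
    (\<exists>u v f g. biregular (edges G) u v f g \<and> (\<forall>x\<in>principal_open (edges G) u.
      laurent_eval (graph_potential G') (f x) = laurent_eval (graph_potential G) x))"
  using assms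
proof (induction rule: rtranclp_induct)
  case base
  then show ?case using biregular_id by blast
next
  case (step H H')
  let ?E = "edges G"
  obtain u v f g where 1: "biregular ?E u v f g" "\<And>x. x \<in> principal_open ?E u \<Longrightarrow>
      laurent_eval (graph_potential H) (f x) = laurent_eval (graph_potential G) x"
    and H: "finite_graph H" "edges H = ?E"
    using step by blast
  obtain u' v' f' g' where 2: "biregular ?E u' v' f' g'" "\<And>x. x \<in> principal_open ?E u' \<Longrightarrow>
      laurent_eval (graph_potential H') (f' x) = laurent_eval (graph_potential H) x"
    using elementary_transformation_biregular[OF step(2) H(1)] H(2) by metis
  \<comment> \<open>The inclusions place \<open>x\<close> and \<open>f x\<close> in the domains
    where the two potential identities hold, so these can be chained.\<close>
  obtain w z where "biregular ?E w z (\<lambda>x. f' (f x)) (\<lambda>y. g (g' y))"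
    "principal_open ?E w \<subseteq> principal_open ?E u" "f ` principal_open ?E w \<subseteq> principal_open ?E u'"
    using biregular_compose[OF 1(1) 2(1)] by blast
  moreover have "edges H' = ?E"
    using step(2) H(2) by (simp add: elementary_transformation_def)
  moreover have "finite_graph H'"
    using step(2) H(1) by (rule elementary_transformation_finite_graph)
  moreover have "\<forall>x\<in>principal_open ?E w.
      laurent_eval (graph_potential H') (f' (f x)) = laurent_eval (graph_potential G) x"
    using calculation(2,3) 1(2) 2(2) by (simp add: image_subset_iff subset_iff)
  ultimately show ?case by blast
qed

theorem theorem1p1:
  fixes \<Gamma> \<Gamma>' :: "('v, 'h, 'e) colored_graph"
  assumes "trivalent_graph \<Gamma>" and "trivalent_graph \<Gamma>'"
    and "elementary_transformation\<^sup>*\<^sup>* \<Gamma> \<Gamma>'"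
  shows "\<exists>U \<phi>. birational_map (edges \<Gamma>) (edges \<Gamma>') U \<phi> \<and>
           (\<forall>x\<in>U. laurent_eval (graph_potential \<Gamma>') (\<phi> x) = laurent_eval (graph_potential \<Gamma>) x)"
proof -
  have "finite_graph \<Gamma>"
    using assms(1) by (simp add: trivalent_graph_def finite_graph_def)
  \<comment> \<open>Equality of the edge sets identifies the two tori; \<open>U\<close> is the
    principal open domain.\<close>
  from elementary_transformations_biregular[OF assms(3) this] show ?thesis
    using biregular_birational_map by metis
qed

end
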